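(* Let $m = 2m_0 \ge 4$ and $n = 2n_0 \ge 6$ be integers (with $m_0, n_0$ integers), and let $s$ be an odd integer such that $\mathrm{ord}_{n_0}(s^2) = m_0$ and $s^m \equiv 1 \pmod n$. Suppose that the group $G_{m_0,n_0,s^2}$, with its generators $x,y$, satisfies the following two conditions. (A) $\mathsf{E}(G_{m_0,n_0,s^2}) = m_0n_0 + m_0 + n_0 - 2$. (B) Every $m_0n_0$-product-one free sequence $S$ over $G_{m_0,n_0,s^2}$ of length $|S| = \mathsf{E}(G_{m_0,n_0,s^2}) - 1$ consists precisely of the following terms, counted with multiplicity: the element $y^{\alpha}$ repeated $\ell n_0 - 1$ times, the element $y^{\beta}$ repeated $(m_0+1-\ell)n_0 - 1$ times, and the $m_0-1$ terms $x^{w}y^{\gamma_1}, \dots, x^{w}y^{\gamma_{m_0-1}}$, for some integers $\alpha, \beta, \gamma_1,\dots,\gamma_{m_0-1} \in [0,n_0-1]$ with $\gcd(\alpha-\beta, n_0) = 1$, some $w \in [1,m_0-1]$ with $\gcd(w,m_0)=1$, and some $\ell \in [1,m_0]$. Then $\mathsf{E}(G_{m,n,s}) = mn + m + n - 2$.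
   Context: $[a,b]$ denotes the set of integers between $a$ and $b$ inclusive. For an integer $s$ coprime to $n$, $\mathrm{ord}_n(s)$ is the multiplicative order of $s$ modulo $n$. For positive integers $m,n$ and an integer $s$ with $s^m \equiv 1 \pmod n$ (equivalently $\mathrm{ord}_n(s) \mid m$), $G_{m,n,s} = C_n \rtimes_s C_m = \langle x, y \mid x^m = y^n = 1,\ yx = xy^s\rangle$, a metacyclic group of order $mn$. In particular $G_{m_0,n_0,s^2} = \langle x,y \mid x^{m_0} = y^{n_0} = 1,\ yx = xy^{s^2}\rangle$. Let $G$ be a finite multiplicative group. A sequence over $G$ is a finite unordered collection of elements of $G$ with repetition allowed (a finite multiset); its length $|S|$ is the number of terms counted with multiplicity, and a subsequence is a sub-multiset. A sequence $S$ with terms $g_1,\dots,g_k$ is a product-one sequence if there is a permutation $\tau$ of $\{1,\dots,k\}$ with $g_{\tau(1)} \cdots g_{\tau(k)} = 1$. For a positive integer $N$, $S$ is $N$-product-one free if it has no product-one subsequence of length exactly $N$. The Gao constant $\mathsf{E}(G)$ is the smallest $\ell > 0$ such that every sequence $S$ over $G$ of length $|S| \ge \ell$ has a product-one subsequence of length exactly $|G|$. *)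

theory Defs
  imports "HOL-Algebra.Algebra" "HOL-Number_Theory.Number_Theory" "HOL-Library.Multiset"
begin

section \<open>The metacyclic groups\<close>

text \<open>
  The pair \<open>(a, b)\<close> stands for the normal form \<open>x\<^sup>a y\<^sup>b\<close>. The relation \<open>y x = x y\<^sup>s\<close> gives
  \<open>y\<^sup>b x\<^sup>c = x\<^sup>c y\<^sup>d\<close> with \<open>d = b s\<^sup>c\<close>, which is where the multiplication comes from.
  This is a group only if \<open>m\<close> and \<open>n\<close> are positive and \<open>s\<^sup>m\<close> is congruent to 1 modulo \<open>n\<close>.
\<close>

definition metacyclic :: "nat \<Rightarrow> nat \<Rightarrow> int \<Rightarrow> (nat \<times> int) monoid" where
  "metacyclic m n s =
     \<lparr>carrier = {0..<m} \<times> {0..<int n},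
      monoid.mult = (\<lambda>(a, b) (c, d). ((a + c) mod m, (b * s ^ c + d) mod int n)),
      monoid.one = (0, 0)\<rparr>"

definition gen_x :: "nat \<Rightarrow> nat \<times> int" where
  "gen_x m = (1 mod m, 0)"

definition gen_y :: "nat \<Rightarrow> nat \<times> int" where
  "gen_y n = (0, 1 mod int n)"

lemma carrier_metacyclic: "carrier (metacyclic m n s) = {0..<m} \<times> {0..<int n}"
  and mult_metacyclic: "(a, b) \<otimes>\<^bsub>metacyclic m n s\<^esub> (c, d) = ((a + c) mod m, (b * s ^ c + d) mod int n)"
  and one_metacyclic: "\<one>\<^bsub>metacyclic m n s\<^esub> = (0, 0)"
  by (simp_all add: metacyclic_def)

lemma order_metacyclic: "order (metacyclic m n s) = m * n"
  by (simp add: order_def carrier_metacyclic)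

lemma power_mod_exponent_cong:
  fixes s :: int
  assumes "[s ^ m = 1] (mod int n)"
  shows "[s ^ (k mod m) = s ^ k] (mod int n)"
proof -
  have "[s ^ k = (s ^ m) ^ (k div m) * s ^ (k mod m)] (mod int n)"
    by (simp flip: power_mult power_add)
  moreover have "[(s ^ m) ^ (k div m) * s ^ (k mod m) = 1 ^ (k div m) * s ^ (k mod m)] (mod int n)"
    by (intro cong_mult cong_pow assms cong_refl)
  ultimately show ?thesis
    by (metis cong_sym cong_trans mult_1 power_one)
qed

lemma group_metacyclic:
  assumes "m > 0" "n > 0" and s: "[s ^ m = 1] (mod int n)"
  shows "group (metacyclic m n s)"
proof (rule groupI)
  let ?G = "metacyclic m n s"
  show "\<one>\<^bsub>?G\<^esub> \<in> carrier ?G"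
    using assms by (simp add: one_metacyclic carrier_metacyclic)
  show "p \<otimes>\<^bsub>?G\<^esub> q \<in> carrier ?G" if "p \<in> carrier ?G" "q \<in> carrier ?G" for p q
    using assms by (cases p; cases q) (auto simp: mult_metacyclic carrier_metacyclic)
  show "\<one>\<^bsub>?G\<^esub> \<otimes>\<^bsub>?G\<^esub> p = p" if "p \<in> carrier ?G" for p
    using that by (cases p) (auto simp: one_metacyclic mult_metacyclic carrier_metacyclic)
  show "p \<otimes>\<^bsub>?G\<^esub> q \<otimes>\<^bsub>?G\<^esub> r = p \<otimes>\<^bsub>?G\<^esub> (q \<otimes>\<^bsub>?G\<^esub> r)"
    if "p \<in> carrier ?G" "q \<in> carrier ?G" "r \<in> carrier ?G" for p q r
  proof -
    obtain a b c d e f where pqr: "p = (a, b)" "q = (c, d)" "r = (e, f)"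
      by (metis surj_pair)
    have "[(b * s ^ c + d) mod int n * s ^ e + f = (b * s ^ c + d) * s ^ e + f] (mod int n)"
      by (intro cong_add cong_mult cong_refl) (simp add: cong_def)
    also have "(b * s ^ c + d) * s ^ e + f = b * s ^ (c + e) + (d * s ^ e + f)"
      by (simp add: algebra_simps power_add)
    also have "[b * s ^ (c + e) + (d * s ^ e + f)
        = b * s ^ ((c + e) mod m) + (d * s ^ e + f) mod int n] (mod int n)"
      by (intro cong_add cong_mult cong_refl cong_sym[OF power_mod_exponent_cong[OF s]])
        (simp add: cong_def)
    finally show ?thesis
      by (simp add: pqr mult_metacyclic cong_def mod_add_left_eq mod_add_right_eq add.assoc)
  qed
  show "\<exists>q\<in>carrier ?G. q \<otimes>\<^bsub>?G\<^esub> p = \<one>\<^bsub>?G\<^esub>" if "p \<in> carrier ?G" for p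
  proof -
    obtain a b where p: "p = (a, b)" "a < m"
      using \<open>p \<in> carrier ?G\<close> by (auto simp: carrier_metacyclic)
    let ?q = "((m - a) mod m, (- b * s ^ (m - a)) mod int n)"
    have "[(- b * s ^ (m - a)) mod int n * s ^ a + b = - b * s ^ (m - a) * s ^ a + b] (mod int n)"
      by (intro cong_add cong_mult cong_refl) (simp add: cong_def)
    also have "- b * s ^ (m - a) * s ^ a + b = - b * s ^ m + b"
      using p by (simp add: mult.assoc flip: power_add)
    also have "[- b * s ^ m + b = - b * 1 + b] (mod int n)"
      by (intro cong_add cong_mult cong_refl s)
    finally have "?q \<otimes>\<^bsub>?G\<^esub> p = \<one>\<^bsub>?G\<^esub>"
      using p by (simp add: mult_metacyclic one_metacyclic cong_def mod_add_left_eq)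
    moreover have "?q \<in> carrier ?G"
      using assms by (simp add: carrier_metacyclic)
    ultimately show ?thesis
      by blast
  qed
qed

text \<open>
  The next results say that \<open>metacyclic m n s\<close> is the group presented by
  \<open>x\<^sup>m = y\<^sup>n = 1\<close>, \<open>y x = x y\<^sup>s\<close>: the two elements satisfy the relations, they generate
  (every element has the form \<open>x\<^sup>a y\<^sup>b\<close>), and any two elements of a group that satisfy the
  relations are the images of \<open>x\<close> and \<open>y\<close> under a homomorphism.
\<close>

context
  fixes m n :: nat and s :: int and G (structure)
  assumes pos: "m > 0" "n > 0" and s: "[s ^ m = 1] (mod int n)"
  defines "G \<equiv> metacyclic m n s"
begin

interpretation group G
  unfolding G_def using pos s by (rule group_metacyclic)

lemma gens_in_carrier: "gen_x m \<in> carrier G" "gen_y n \<in> carrier G"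
  using pos by (simp_all add: G_def carrier_metacyclic gen_x_def gen_y_def)

lemma gen_x_pow: "gen_x m [^] (a::nat) = (a mod m, 0)"
  by (induction a) (simp_all add: G_def one_metacyclic mult_metacyclic gen_x_def mod_Suc_eq
    mod_add_eq)

lemma gen_y_pow: "gen_y n [^] (b::nat) = (0, int b mod int n)"
  by (induction b) (simp_all add: G_def one_metacyclic mult_metacyclic gen_y_def mod_simps add.commute)

lemma gen_y_int_pow: "gen_y n [^] (b::int) = (0, b mod int n)"
proof -
  have n: "gen_y n [^] int n = \<one>"
    by (simp add: int_pow_int gen_y_pow) (simp add: G_def one_metacyclic)
  have "gen_y n [^] b = gen_y n [^] (int n * (b div int n) + b mod int n)"
    by simp
  also have "\<dots> = gen_y n [^] (b mod int n)"
    using gens_in_carrier by (subst int_pow_mult) (simp_all add: n flip: int_pow_pow)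
  also have "\<dots> = gen_y n [^] nat (b mod int n)"
    using pos by (metis int_pow_int nat_0_le pos_mod_sign of_nat_0_less_iff)
  finally show ?thesis
    using pos by (simp add: gen_y_pow)
qed

lemma metacyclic_relations:
  "gen_x m [^] m = \<one>" "gen_y n [^] n = \<one>"
  "gen_y n \<otimes> gen_x m = gen_x m \<otimes> gen_y n [^] s"
  using pos s
  by (simp_all add: gen_x_pow gen_y_pow gen_y_int_pow)
    (auto simp: G_def one_metacyclic mult_metacyclic gen_x_def gen_y_def mod_simps cong_def
      mod_if[of 1 m])

lemma metacyclic_normal_form:
  assumes "(a, b) \<in> carrier G"
  shows "(a, b) = gen_x m [^] a \<otimes> gen_y n [^] b"
  using assms
  by (simp add: gen_x_pow gen_y_int_pow) (simp add: G_def carrier_metacyclic mult_metacyclic)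

lemma metacyclic_universal:
  assumes "group H" and uv: "u \<in> carrier H" "v \<in> carrier H"
    and um: "u [^]\<^bsub>H\<^esub> m = \<one>\<^bsub>H\<^esub>" and vn: "v [^]\<^bsub>H\<^esub> n = \<one>\<^bsub>H\<^esub>"
    and vu: "v \<otimes>\<^bsub>H\<^esub> u = u \<otimes>\<^bsub>H\<^esub> v [^]\<^bsub>H\<^esub> s"
  shows "\<exists>h \<in> hom G H. h (gen_x m) = u \<and> h (gen_y n) = v"
proof -
  interpret H: group H by fact
  have um': "u [^]\<^bsub>H\<^esub> (k mod m) = u [^]\<^bsub>H\<^esub> k" for k
  proof -
    have "u [^]\<^bsub>H\<^esub> k = u [^]\<^bsub>H\<^esub> (m * (k div m) + k mod m)"
      by simp
    also have "\<dots> = u [^]\<^bsub>H\<^esub> (k mod m)"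
      using uv by (subst H.nat_pow_mult[symmetric]) (simp_all add: um flip: H.nat_pow_pow)
    finally show ?thesis ..
  qed
  have vn': "v [^]\<^bsub>H\<^esub> (k mod int n) = v [^]\<^bsub>H\<^esub> k" for k
  proof -
    have "v [^]\<^bsub>H\<^esub> k = v [^]\<^bsub>H\<^esub> (int n * (k div int n) + k mod int n)"
      by simp
    also have "\<dots> = v [^]\<^bsub>H\<^esub> (k mod int n)"
      using uv by (subst H.int_pow_mult) (simp_all add: vn int_pow_int flip: H.int_pow_pow)
    finally show ?thesis ..
  qed
  have conj: "inv\<^bsub>H\<^esub> u \<otimes>\<^bsub>H\<^esub> v \<otimes>\<^bsub>H\<^esub> u = v [^]\<^bsub>H\<^esub> s"
    using vu uv by (simp add: H.m_assoc H.inv_solve_left')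
  have cancel: "u \<otimes>\<^bsub>H\<^esub> (inv\<^bsub>H\<^esub> u \<otimes>\<^bsub>H\<^esub> z) = z" if "z \<in> carrier H" for z
    using that uv by (simp flip: H.m_assoc)
  have hom: "(\<lambda>z. inv\<^bsub>H\<^esub> u \<otimes>\<^bsub>H\<^esub> z \<otimes>\<^bsub>H\<^esub> u) \<in> hom H H"
    using uv by (auto simp: hom_def H.m_assoc cancel)
  have step: "v [^]\<^bsub>H\<^esub> b \<otimes>\<^bsub>H\<^esub> u = u \<otimes>\<^bsub>H\<^esub> v [^]\<^bsub>H\<^esub> (b * s)" for b :: int
  proof -
    have "inv\<^bsub>H\<^esub> u \<otimes>\<^bsub>H\<^esub> v [^]\<^bsub>H\<^esub> b \<otimes>\<^bsub>H\<^esub> u = (v [^]\<^bsub>H\<^esub> s) [^]\<^bsub>H\<^esub> b"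
      using hom_int_pow[OF hom uv(2) \<open>group H\<close> \<open>group H\<close>] conj by simp
    then show ?thesis
      using uv by (simp add: H.int_pow_pow mult.commute H.m_assoc H.inv_solve_left')
  qed
  have steps: "v [^]\<^bsub>H\<^esub> b \<otimes>\<^bsub>H\<^esub> u [^]\<^bsub>H\<^esub> c = u [^]\<^bsub>H\<^esub> c \<otimes>\<^bsub>H\<^esub> v [^]\<^bsub>H\<^esub> (b * s ^ c)"
    for b :: int and c :: nat
  proof (induction c)
    case (Suc c)
    have "v [^]\<^bsub>H\<^esub> b \<otimes>\<^bsub>H\<^esub> u [^]\<^bsub>H\<^esub> Suc c = (v [^]\<^bsub>H\<^esub> b \<otimes>\<^bsub>H\<^esub> u [^]\<^bsub>H\<^esub> c) \<otimes>\<^bsub>H\<^esub> u"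
      using uv by (simp add: H.m_assoc)
    also have "\<dots> = u [^]\<^bsub>H\<^esub> c \<otimes>\<^bsub>H\<^esub> (v [^]\<^bsub>H\<^esub> (b * s ^ c) \<otimes>\<^bsub>H\<^esub> u)"
      using uv by (simp add: Suc H.m_assoc)
    also have "\<dots> = u [^]\<^bsub>H\<^esub> Suc c \<otimes>\<^bsub>H\<^esub> v [^]\<^bsub>H\<^esub> (b * s ^ Suc c)"
      using uv by (simp add: step H.m_assoc mult_ac)
    finally show ?case .
  qed (use uv in simp)
  define h where "h = (\<lambda>(a::nat, b::int). u [^]\<^bsub>H\<^esub> a \<otimes>\<^bsub>H\<^esub> v [^]\<^bsub>H\<^esub> b)"
  have "h ((a, b) \<otimes> (c, d)) = h (a, b) \<otimes>\<^bsub>H\<^esub> h (c, d)" for a b c d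
  proof -
    have "h (a, b) \<otimes>\<^bsub>H\<^esub> h (c, d)
        = u [^]\<^bsub>H\<^esub> a \<otimes>\<^bsub>H\<^esub> (v [^]\<^bsub>H\<^esub> b \<otimes>\<^bsub>H\<^esub> u [^]\<^bsub>H\<^esub> c) \<otimes>\<^bsub>H\<^esub> v [^]\<^bsub>H\<^esub> d"
      using uv by (simp add: h_def H.m_assoc)
    also have "\<dots> = (u [^]\<^bsub>H\<^esub> a \<otimes>\<^bsub>H\<^esub> u [^]\<^bsub>H\<^esub> c) \<otimes>\<^bsub>H\<^esub> (v [^]\<^bsub>H\<^esub> (b * s ^ c) \<otimes>\<^bsub>H\<^esub> v [^]\<^bsub>H\<^esub> d)"
      using uv by (simp add: steps H.m_assoc)
    also have "\<dots> = h ((a, b) \<otimes> (c, d))"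
      using uv by (simp add: G_def mult_metacyclic h_def um' vn' H.nat_pow_mult H.int_pow_mult)
    finally show ?thesis ..
  qed
  then have "h \<in> hom G H"
    using uv by (auto simp: hom_def h_def)
  moreover have "h (gen_x m) = u" "h (gen_y n) = v"
    using uv um'[of 1] vn'[of 1] by (simp_all add: h_def gen_x_def gen_y_def)
  ultimately show ?thesis
    by blast
qed

end


section \<open>Product-one sequences and the Gao constant\<close>

definition product_one :: "('a, 'b) monoid_scheme \<Rightarrow> 'a multiset \<Rightarrow> bool" where
  "product_one G S \<longleftrightarrow> (\<exists>gs. mset gs = S \<and> foldr (\<otimes>\<^bsub>G\<^esub>) gs \<one>\<^bsub>G\<^esub> = \<one>\<^bsub>G\<^esub>)"

definition has_product_one_subseq :: "('a, 'b) monoid_scheme \<Rightarrow> nat \<Rightarrow> 'a multiset \<Rightarrow> bool" where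
  "has_product_one_subseq G N S \<longleftrightarrow> (\<exists>T. T \<subseteq># S \<and> size T = N \<and> product_one G T)"

abbreviation product_one_free :: "('a, 'b) monoid_scheme \<Rightarrow> nat \<Rightarrow> 'a multiset \<Rightarrow> bool" where
  "product_one_free G N S \<equiv> \<not> has_product_one_subseq G N S"

text \<open>
  For a finite group \<open>G\<close> the minimum exists: among \<open>(order G)\<^sup>2\<close> terms some \<open>g\<close> occurs at
  least \<open>order G\<close> times, and \<open>g\<close> to the power \<open>order G\<close> is 1.
\<close>

definition gao_const :: "('a, 'b) monoid_scheme \<Rightarrow> nat" where
  "gao_const G = (LEAST l. l > 0 \<and>
     (\<forall>S. set_mset S \<subseteq> carrier G \<and> size S \<ge> l \<longrightarrow> has_product_one_subseq G (order G) S))"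

end

theory Submission
  imports Defs
begin

text \<open>
  The elements of \<open>G\<^bsub>m,n,s\<^esub>\<close> both of whose exponents are even form a copy \<open>K\<close> of
  \<open>G\<^sub>0 = G\<^bsub>m\<^sub>0,n\<^sub>0,s\<^sup>2\<^esub>\<close>, the kernel of the parity map onto \<open>C\<^sub>2 \<oplus> C\<^sub>2\<close>.

  \<^emph>\<open>Upper bound.\<close> Let \<open>S\<close> have \<open>mn + m + n - 2\<close> terms. Pair off terms of equal parity class; every
  pair has its product in \<open>K\<close>, and at most four terms, of distinct classes, are left over
  (\<open>pair_by_class\<close>). A product-one sequence of \<open>m\<^sub>0n\<^sub>0\<close> pair products yields a product-one
  subsequence of \<open>S\<close> of length \<open>2m\<^sub>0n\<^sub>0\<close> (\<open>product_one_blocks\<close>), and two disjoint ones yield the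
  length \<open>mn = 4m\<^sub>0n\<^sub>0\<close>. Hypothesis (A) provides both of them if there are at least
  \<open>2m\<^sub>0n\<^sub>0 + m\<^sub>0 + n\<^sub>0 - 2\<close> pairs, which fails only if all four classes are left over, and then by
  a single pair. In that case (A) provides one of them, and the sequence \<open>R\<close> of the remaining
  pair products has length \<open>E(G\<^sub>0) - 1\<close>. If \<open>R\<close> does not provide the second one, it has the
  form stated in (B). The four leftover terms multiply to an element \<open>z\<close> of \<open>K\<close>, so they may take
  the place of two pairs: it is enough that \<open>z\<close> together with some \<open>m\<^sub>0n\<^sub>0 - 2\<close> terms of \<open>R\<close> is a
  product-one sequence. This holds for any \<open>z\<close> (\<open>extremal_completes\<close>): some \<open>j < m\<^sub>0\<close> of the
  terms \<open>x\<^sup>wy\<^sup>\<gamma>\<close> cancel the exponent of \<open>x\<close>, because \<open>w\<close> is coprime to \<open>m\<^sub>0\<close>, and the number of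
  terms \<open>y\<^sup>\<alpha>\<close> among the others can still take \<open>n\<^sub>0\<close> consecutive values. Replacing a \<open>y\<^sup>\<beta>\<close> by a
  \<open>y\<^sup>\<alpha>\<close> changes the exponent of \<open>y\<close> by \<open>\<alpha> - \<beta>\<close>, which is coprime to \<open>n\<^sub>0\<close>, so one of these
  values cancels that exponent.

  \<^emph>\<open>Lower bound.\<close> The sequence of \<open>mn - 1\<close> terms \<open>1\<close>, \<open>m - 1\<close> terms \<open>x\<close> and \<open>n - 1\<close> terms \<open>y\<close>
  is \<open>mn\<close>-product-one free (\<open>product_one_free_example\<close>).
\<close>

section \<open>Products of lists in a group\<close>

abbreviation gprod :: "('a, 'b) monoid_scheme \<Rightarrow> 'a list \<Rightarrow> 'a" where
  "gprod G gs \<equiv> foldr (\<otimes>\<^bsub>G\<^esub>) gs \<one>\<^bsub>G\<^esub>"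

context group
begin

lemma gprod_closed: "set gs \<subseteq> carrier G \<Longrightarrow> gprod G gs \<in> carrier G"
  by (induction gs) auto

lemma gprod_append:
  "set gs \<subseteq> carrier G \<Longrightarrow> set hs \<subseteq> carrier G \<Longrightarrow> gprod G (gs @ hs) = gprod G gs \<otimes> gprod G hs"
  by (induction gs) (auto simp: m_assoc gprod_closed)

lemma gprod_concat:
  "\<forall>gs\<in>set gss. set gs \<subseteq> carrier G \<Longrightarrow> gprod G (concat gss) = gprod G (map (gprod G) gss)"
proof (induction gss)
  case (Cons gs gss)
  then have "set gs \<subseteq> carrier G" "set (concat gss) \<subseteq> carrier G"
    by auto
  with Cons gprod_append[of gs "concat gss"] show ?case
    by simp
qed simp

lemma gprod_replicate: "g \<in> carrier G \<Longrightarrow> gprod G (replicate k g) = g [^] k"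
  by (induction k) (simp_all add: nat_pow_Suc2[symmetric] del: nat_pow_Suc)

lemma product_one_union:
  assumes "set_mset A \<subseteq> carrier G" "set_mset B \<subseteq> carrier G" "product_one G A" "product_one G B"
  shows "product_one G (A + B)"
proof -
  obtain as bs where "mset as = A" "gprod G as = \<one>" "mset bs = B" "gprod G bs = \<one>"
    using assms by (auto simp: product_one_def)
  then have "mset (as @ bs) = A + B \<and> gprod G (as @ bs) = \<one>"
    using assms(1,2) by (subst gprod_append) (auto simp flip: set_mset_mset)
  then show ?thesis
    unfolding product_one_def by blast
qed

end

text \<open>
  The order in which a product-one sequence of block products has to be multiplied is an order for
  the blocks, and the concatenation of the blocks in that order has product one.
\<close>

lemma product_one_blocks:
  assumes "group G" "group H" and \<iota>: "\<iota> \<in> hom H G"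
    and blocks: "\<And>gs. gs \<in># \<B> \<Longrightarrow> set gs \<subseteq> carrier G \<and> p gs \<in> carrier H \<and> gprod G gs = \<iota> (p gs)"
    and one: "product_one H (image_mset p \<B>)"
  shows "product_one G (\<Sum>\<^sub># (image_mset mset \<B>))"
proof -
  interpret G: group G by fact
  interpret H: group H by fact
  interpret \<iota>: group_hom H G \<iota> by unfold_locales fact
  obtain hs where hs: "mset hs = image_mset p \<B>" "gprod H hs = \<one>\<^bsub>H\<^esub>"
    using one by (auto simp: product_one_def)
  have order_blocks: "\<exists>gss. mset gss = \<C> \<and> map p gss = ks" if "mset ks = image_mset p \<C>" for ks \<C>
    using that
  proof (induction ks arbitrary: \<C>)
    case (Cons k ks)
    then obtain \<C>' gs where \<C>': "\<C> = add_mset gs \<C>'" "p gs = k" "image_mset p \<C>' = mset ks"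
      by (metis mset.simps(2) msed_map_invR)
    with Cons.IH[of \<C>'] obtain gss where "mset gss = \<C>'" "map p gss = ks"
      by auto
    with \<C>' have "mset (gs # gss) = \<C> \<and> map p (gs # gss) = k # ks"
      by simp
    then show ?case
      by (rule exI)
  qed simp
  obtain gss where gss: "mset gss = \<B>" "map p gss = hs"
    using order_blocks[OF hs(1)] by blast
  have gss_blocks: "\<forall>gs\<in>set gss. set gs \<subseteq> carrier G \<and> p gs \<in> carrier H \<and> gprod G gs = \<iota> (p gs)"
    using blocks gss(1) by (metis set_mset_mset)
  then have "gprod G (map (gprod G) gss) = \<iota> (gprod H (map p gss))"
  proof (induction gss)
    case (Cons gs gss)
    then have "gprod H (map p gss) \<in> carrier H"
      by (intro H.gprod_closed) auto
    with Cons show ?case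
      by simp
  qed simp
  then have "gprod G (concat gss) = \<one>\<^bsub>G\<^esub>"
    using gss_blocks gss(2) hs(2) by (simp add: G.gprod_concat)
  moreover have "mset (concat gss) = \<Sum>\<^sub># (image_mset mset \<B>)"
    by (simp add: mset_concat gss(1)[symmetric] flip: sum_mset_sum_list)
  ultimately show ?thesis
    unfolding product_one_def by blast
qed


section \<open>Computing the Gao constant\<close>

text \<open>
  The set whose least element is the Gao constant is not empty, by the pigeonhole principle: a term
  that occurs \<open>|G|\<close> times gives a product-one subsequence, as \<open>g\<close> to the power \<open>|G|\<close> is 1.
\<close>

lemma has_product_one_subseq_of_long:
  assumes "group G" "finite (carrier G)"
    and S: "set_mset S \<subseteq> carrier G" "size S \<ge> order G * order G"
  shows "has_product_one_subseq G (order G) S"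
proof -
  interpret group G by fact
  have N: "order G > 0"
    using assms by (simp add: order_gt_0_iff_finite)
  have "\<exists>g\<in>set_mset S. count S g \<ge> order G"
  proof (rule ccontr)
    assume "\<not> ?thesis"
    then have "size S \<le> (\<Sum>g\<in>set_mset S. order G - 1)"
      unfolding size_multiset_overloaded_eq by (intro sum_mono) (force simp: not_le)
    also have "\<dots> \<le> order G * (order G - 1)"
      using card_mono[OF assms(2) S(1)] by (simp add: order_def)
    also have "\<dots> < order G * order G"
      using N by simp
    finally show False
      using S(2) by simp
  qed
  then obtain g where g: "g \<in># S" "count S g \<ge> order G"
    by blast
  have "gprod G (replicate (order G) g) = \<one>\<^bsub>G\<^esub>"
    using g(1) S(1) by (simp add: gprod_replicate subset_eq pow_order_eq_1 del: foldr_replicate)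
  then have "product_one G (replicate_mset (order G) g)"
    unfolding product_one_def by (metis mset_replicate)
  with g(2) show ?thesis
    unfolding has_product_one_subseq_def count_le_replicate_mset_subset_eq
    by (metis size_replicate_mset)
qed

lemma has_product_one_subseq_mono:
  assumes "has_product_one_subseq G N S" "S \<subseteq># S'"
  shows "has_product_one_subseq G N S'"
proof -
  obtain T where "T \<subseteq># S" "size T = N" "product_one G T"
    using assms(1) by (auto simp: has_product_one_subseq_def)
  moreover from this(1) assms(2) have "T \<subseteq># S'"
    by (rule subset_mset.order_trans)
  ultimately show ?thesis
    unfolding has_product_one_subseq_def by blast
qed

lemma has_product_one_subseq_gao:
  assumes "group G" "finite (carrier G)"
    and S: "set_mset S \<subseteq> carrier G" "size S \<ge> gao_const G"
  shows "has_product_one_subseq G (order G) S"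
proof -
  let ?P = "\<lambda>l. l > 0 \<and>
     (\<forall>S. set_mset S \<subseteq> carrier G \<and> size S \<ge> l \<longrightarrow> has_product_one_subseq G (order G) S)"
  have "order G > 0"
    using assms by (simp add: monoid.order_gt_0_iff_finite group.is_monoid)
  then have "?P (order G * order G)"
    using has_product_one_subseq_of_long[OF assms(1,2)] by simp
  then have "?P (gao_const G)"
    unfolding gao_const_def by (rule LeastI)
  with S show ?thesis
    by blast
qed

lemma gao_const_eqI:
  assumes upper: "\<And>S. set_mset S \<subseteq> carrier G \<Longrightarrow> size S = Suc l \<Longrightarrow>
      has_product_one_subseq G (order G) S"
    and lower: "set_mset S0 \<subseteq> carrier G" "size S0 = l" "product_one_free G (order G) S0"
  shows "gao_const G = Suc l"
  unfolding gao_const_def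
proof (rule Least_equality)
  have "has_product_one_subseq G (order G) S" if S: "set_mset S \<subseteq> carrier G" "size S \<ge> Suc l" for S
  proof -
    obtain xs where xs: "mset xs = S"
      using ex_mset by blast
    have sub: "mset (take (Suc l) xs) \<subseteq># S"
      unfolding xs[symmetric] by (metis append_take_drop_id mset_append mset_subset_eq_add_left)
    moreover have "size (mset (take (Suc l) xs)) = Suc l"
      using S(2) by (auto simp: xs[symmetric])
    moreover have "set_mset (mset (take (Suc l) xs)) \<subseteq> carrier G"
      using set_mset_mono[OF sub] S(1) by blast
    ultimately show ?thesis
      using upper has_product_one_subseq_mono by blast
  qed
  then show "0 < Suc l \<and> (\<forall>S. set_mset S \<subseteq> carrier G \<and> Suc l \<le> size S \<longrightarrow>
      has_product_one_subseq G (order G) S)"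
    by simp
next
  fix k
  assume "0 < k \<and> (\<forall>S. set_mset S \<subseteq> carrier G \<and> k \<le> size S \<longrightarrow>
      has_product_one_subseq G (order G) S)"
  with lower show "Suc l \<le> k"
    by (metis not_less_eq_eq)
qed


section \<open>Exponents in metacyclic groups\<close>

lemma fst_gprod: "fst (gprod (metacyclic m n s) gs) = (\<Sum>g\<leftarrow>gs. fst g) mod m"
proof (induction gs)
  case (Cons g gs)
  then show ?case
    by (cases g; cases "gprod (metacyclic m n s) gs") (simp add: mult_metacyclic mod_simps)
qed (simp add: one_metacyclic)

lemma gprod_powers_of_y:
  assumes "m > 0" "\<forall>g\<in>set gs. fst g = 0"
  shows "gprod (metacyclic m n s) gs = (0, (\<Sum>g\<leftarrow>gs. snd g) mod int n)"
  using assms(2)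
proof (induction gs)
  case (Cons g gs)
  then show ?case
    using assms(1) by (cases g) (simp add: mult_metacyclic mod_simps)
qed (simp add: one_metacyclic)

text \<open>
  A product-one subsequence has too few terms \<open>x\<close> for their number to be a positive multiple of
  \<open>m\<close>, so it has none; what remains are powers of \<open>y\<close>, and in the same way no \<open>y\<close> is left. The
  terms \<open>1\<close> alone are one short of \<open>mn\<close>.
\<close>

lemma product_one_free_example:
  assumes m: "m > 0" and n: "n > 0"
  defines "S \<equiv> replicate_mset (m * n - 1) (0, 0) + replicate_mset (m - 1) (1, 0)
      + replicate_mset (n - 1) (0, 1)"
  shows "set_mset S \<subseteq> carrier (metacyclic m n s)"
    and "size S + 2 = m * n + m + n - 1"
    and "product_one_free (metacyclic m n s) (m * n) S"
proof -
  show "set_mset S \<subseteq> carrier (metacyclic m n s)"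
    using m n by (auto simp: S_def carrier_metacyclic split: if_splits)
  have "m * n > 0"
    using m n by simp
  moreover have "size S = (m * n - 1) + (m - 1) + (n - 1)"
    by (simp add: S_def)
  ultimately show "size S + 2 = m * n + m + n - 1"
    using m n by linarith
  show "product_one_free (metacyclic m n s) (m * n) S"
  proof
    assume "has_product_one_subseq (metacyclic m n s) (m * n) S"
    then obtain gs where sub: "mset gs \<subseteq># S" and len: "length gs = m * n"
      and one: "gprod (metacyclic m n s) gs = (0, 0)"
      by (auto simp: has_product_one_subseq_def product_one_def one_metacyclic)
    have bound: "count (mset gs) g \<le> count S g" for g
      using sub unfolding subseteq_mset_def by blast
    have "set gs \<subseteq> set_mset S"
      using set_mset_mono[OF sub] by simp
    then have terms: "set gs \<subseteq> {(0, 0), (1, 0), (0, 1)}"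
      by (auto simp: S_def split: if_splits)
    then have "(\<Sum>g\<leftarrow>gs. fst g) = count (mset gs) (1, 0)"
      by (induction gs) auto
    moreover have "(\<Sum>g\<leftarrow>gs. fst g) mod m = 0"
      using one fst_gprod[of m n s gs] by simp
    moreover have "count (mset gs) (1, 0) < m"
      using bound[of "(1, 0)"] m by (simp add: S_def)
    ultimately have no_x: "count (mset gs) (1, 0) = 0"
      by simp
    have "\<forall>g\<in>set gs. fst g = 0"
    proof
      fix g
      assume "g \<in> set gs"
      with terms no_x show "fst g = 0"
        by (auto simp: count_eq_zero_iff)
    qed
    then have "gprod (metacyclic m n s) gs = (0, (\<Sum>g\<leftarrow>gs. snd g) mod int n)"
      using m by (rule gprod_powers_of_y[rotated])
    moreover have "(\<Sum>g\<leftarrow>gs. snd g) = int (count (mset gs) (0, 1))"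
      using terms by (induction gs) auto
    moreover have "count (mset gs) (0, 1) < n"
      using bound[of "(0, 1)"] n by (simp add: S_def)
    ultimately have no_y: "count (mset gs) (0, 1) = 0"
      using one by simp
    have "set gs \<subseteq> {(0, 0)}"
      using terms no_x no_y by (auto simp: count_eq_zero_iff)
    then have "gs = replicate (m * n) (0, 0)"
      using len by (metis replicate_length_same singletonD subsetD)
    then have "count (mset gs) (0, 0) = m * n"
      by simp
    moreover have "count S (0, 0) = m * n - 1"
      by (simp add: S_def)
    ultimately show False
      using bound[of "(0, 0)"] \<open>m * n > 0\<close> by linarith
  qed
qed


section \<open>The subgroup of elements with even exponents\<close>

definition double :: "nat \<times> int \<Rightarrow> nat \<times> int" where
  "double = (\<lambda>(a, b). (2 * a, 2 * b))"

definition halve :: "nat \<times> int \<Rightarrow> nat \<times> int" where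
  "halve = (\<lambda>(a, b). (a div 2, b div 2))"

definition parity_class :: "nat \<times> int \<Rightarrow> bool \<times> bool" where
  "parity_class = (\<lambda>(a, b). (even a, even b))"

text \<open>The twist is squared because moving \<open>y\<^sup>2\<close> past \<open>x\<^sup>2\<close> applies the twist by \<open>s\<close> twice.\<close>

lemma double_hom: "double \<in> hom (metacyclic m n (s\<^sup>2)) (metacyclic (2 * m) (2 * n) s)"
proof (rule homI)
  fix p q
  show "double (p \<otimes>\<^bsub>metacyclic m n (s\<^sup>2)\<^esub> q)
      = double p \<otimes>\<^bsub>metacyclic (2 * m) (2 * n) s\<^esub> double q"
    by (cases p; cases q)
      (simp add: double_def mult_metacyclic mult_mod_right algebra_simps flip: power_mult)
qed (auto simp: double_def carrier_metacyclic)

lemma double_halve: "parity_class p = (True, True) \<Longrightarrow> double (halve p) = p"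
  by (auto simp: parity_class_def double_def halve_def split: prod.splits)

lemma halve_closed:
  "p \<in> carrier (metacyclic (2 * m) (2 * n) s) \<Longrightarrow> halve p \<in> carrier (metacyclic m n (s\<^sup>2))"
  by (auto simp: halve_def carrier_metacyclic)

lemma parity_class_mult:
  assumes "odd s"
  shows "parity_class (p \<otimes>\<^bsub>metacyclic (2 * m) (2 * n) s\<^esub> q)
    = (fst (parity_class p) = fst (parity_class q), snd (parity_class p) = snd (parity_class q))"
  using assms
  by (cases p; cases q) (auto simp: parity_class_def mult_metacyclic dvd_mod_iff)

lemma parity_class_gprod:
  assumes "odd s"
  shows "parity_class (gprod (metacyclic (2 * m) (2 * n) s) gs)
    = (even (\<Sum>g\<leftarrow>gs. of_bool (\<not> fst (parity_class g)) :: nat),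
       even (\<Sum>g\<leftarrow>gs. of_bool (\<not> snd (parity_class g)) :: nat))"
proof (induction gs)
  case (Cons g gs)
  then show ?case
    by (cases "parity_class g") (auto simp: parity_class_mult[OF assms])
qed (simp add: parity_class_def one_metacyclic)

text \<open>
  Greedy pairing: a new term either completes a pair with a leftover term of its class, or joins
  the leftover terms as the only one of its class.
\<close>

lemma pair_by_class:
  fixes cls :: "'a \<Rightarrow> 'c::finite"
  shows "\<exists>\<P> L. S = \<Sum>\<^sub># (image_mset mset \<P>) + L \<and>
    (\<forall>gs\<in>#\<P>. \<exists>g h. gs = [g, h] \<and> cls g = cls h) \<and> image_mset cls L \<subseteq># mset_set UNIV"
proof (induction S)
  case empty
  show ?case
    by (intro exI[of _ "{#}"]) simp
next
  case (add g S)
  then obtain \<P> L where IH: "S = \<Sum>\<^sub># (image_mset mset \<P>) + L"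
    "\<forall>gs\<in>#\<P>. \<exists>g h. gs = [g, h] \<and> cls g = cls h" "image_mset cls L \<subseteq># mset_set UNIV"
    by blast
  show ?case
  proof (cases "\<exists>h\<in>#L. cls g = cls h")
    case True
    then obtain h L' where h: "cls g = cls h" "L = add_mset h L'"
      by (metis mset_add)
    then have "image_mset cls L' \<subseteq># mset_set UNIV"
      using IH(3) by (metis image_mset_add_mset mset_subset_eq_insertD subset_mset.less_imp_le)
    with IH h show ?thesis
      by (intro exI[of _ "add_mset [g, h] \<P>"] exI[of _ L']) auto
  next
    case False
    then have "count (image_mset cls L) (cls g) = 0"
      by (auto simp: count_eq_zero_iff)
    then have "image_mset cls (add_mset g L) \<subseteq># mset_set UNIV"
      using IH(3) by (auto simp: subseteq_mset_def count_mset_set')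
    with IH show ?thesis
      by (intro exI[of _ \<P>] exI[of _ "add_mset g L"]) auto
  qed
qed

lemma parity_classes:
  "(UNIV :: (bool \<times> bool) set) = {(True, True), (True, False), (False, True), (False, False)}"
  by auto

lemma size_parity_classes: "size (mset_set (UNIV :: (bool \<times> bool) set)) = 4"
  by (simp add: parity_classes)

text \<open>
  The term counts that decide the parity of an exponent are unaffected by the order: each of the
  two exponents is odd in exactly two of the four classes.
\<close>

lemma transversal_product_even:
  assumes "odd s" and L: "image_mset parity_class L \<subseteq># mset_set UNIV" "size L \<ge> 4"
  obtains gs where "mset gs = L" "size L = 4"
    "parity_class (gprod (metacyclic (2 * m) (2 * n) s) gs) = (True, True)"
proof -
  have "\<not> image_mset parity_class L \<subset># mset_set UNIV"
    using L(2) mset_subset_size size_parity_classes by fastforce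
  then have all: "image_mset parity_class L = mset_set UNIV"
    using L(1) subset_mset.le_imp_less_or_eq by blast
  obtain gs where gs: "mset gs = L"
    using ex_mset by blast
  have sum: "(\<Sum>g\<leftarrow>gs. f (parity_class g)) = (\<Sum>c\<in>UNIV. f c)" for f :: "bool \<times> bool \<Rightarrow> nat"
  proof -
    have "(\<Sum>g\<leftarrow>gs. f (parity_class g)) = (\<Sum>c\<in>#image_mset parity_class L. f c)"
      by (simp add: gs[symmetric] sum_mset_sum_list[symmetric] multiset.map_comp comp_def)
    then show ?thesis
      by (simp add: all sum_unfold_sum_mset)
  qed
  have "parity_class (gprod (metacyclic (2 * m) (2 * n) s) gs) = (True, True)"
    unfolding parity_class_gprod[OF assms(1)]
    using sum[of "\<lambda>c. of_bool (\<not> fst c)"] sum[of "\<lambda>c. of_bool (\<not> snd c)"] by (simp add: parity_classes)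
  moreover have "size L = 4"
    using all size_parity_classes by (metis size_image_mset)
  ultimately show ?thesis
    using gs that by blast
qed


section \<open>Completing an element by terms of an extremal sequence\<close>

lemma linear_congruence_in_window:
  fixes a c lo N :: int
  assumes "coprime a N" "N > 0"
  obtains u where "lo \<le> u" "u < lo + N" "N dvd c + u * a"
proof -
  obtain v where v: "[a * v = 1] (mod N)"
    using assms(1) cong_solve_coprime_int by blast
  define u where "u = lo + (- c * v - lo) mod N"
  have "[u = lo + (- c * v - lo)] (mod N)"
    unfolding u_def by (intro cong_add) (simp_all add: cong_def)
  then have "[c + u * a = c + (- c * v) * a] (mod N)"
    by (intro cong_add cong_mult) simp_all
  also have "c + (- c * v) * a = c - c * (a * v)"
    by (simp add: algebra_simps)
  also have "[c - c * (a * v) = c - c * 1] (mod N)"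
    by (intro cong_diff cong_mult v cong_refl)
  finally have "N dvd c + u * a"
    by (simp add: cong_0_iff)
  moreover have "lo \<le> u" "u < lo + N"
    using assms(2) by (simp_all add: u_def)
  ultimately show ?thesis
    using that by blast
qed

text \<open>
  Without the \<open>j\<close> terms \<open>x\<^sup>wy\<^sup>\<gamma>\<close>, there remain \<open>M = mn - 2 - j\<close> terms to be chosen from
  \<open>ln - 1\<close> terms \<open>y\<^sup>\<alpha>\<close> and \<open>(m + 1 - l)n - 1\<close> terms \<open>y\<^sup>\<beta>\<close>. The number of terms \<open>y\<^sup>\<alpha>\<close> can start
  at \<open>max 0 ((l - 1)n - 1 - j)\<close>, where the truncated subtraction supplies the maximum.
\<close>

lemma window_of_multiplicities:
  fixes m n l j u :: nat
  assumes "m \<ge> 2" "n \<ge> 3" "j < m" "1 \<le> l" "l \<le> m"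
    and "(l - 1) * n - (1 + j) \<le> u" "u < (l - 1) * n - (1 + j) + n"
  shows "u \<le> l * n - 1" "u \<le> m * n - 2 - j" "m * n - 2 - j - u \<le> (m + 1 - l) * n - 1"
proof -
  obtain l' where l': "l = Suc l'"
    using assms(4) by (cases l) auto
  obtain d where d: "m = l + d"
    using assms(5) le_Suc_ex by blast
  have big: "n + m \<le> m * n"
  proof -
    obtain a b where "m = a + 2" "n = b + 3"
      using assms(1,2) by (metis add.commute le_Suc_ex)
    then show ?thesis
      by (simp add: algebra_simps)
  qed
  define a b where "a = l' * n" and "b = d * n"
  have mn: "m * n = a + n + b" and ln: "l * n = a + n" "(l - 1) * n = a"
    and rn: "(m + 1 - l) * n = b + n"
    by (simp_all add: a_def b_def d l' algebra_simps)
  have lo: "a \<le> u + (1 + j)" and hi: "u < n \<or> u + (1 + j) < a + n"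
    using assms(6,7) unfolding ln by linarith+
  show "u \<le> l * n - 1"
    using hi unfolding ln by linarith
  show "u \<le> m * n - 2 - j"
    using hi big assms(3) unfolding mn by linarith
  show "m * n - 2 - j - u \<le> (m + 1 - l) * n - 1"
    using lo assms(2) unfolding mn rn by linarith
qed

text \<open>
  The terms \<open>x\<^sup>wy\<^sup>\<gamma>\<close> come first, to turn \<open>z\<close> into a power of \<open>y\<close>; the values \<open>\<gamma>\<close> only shift
  which power this is, and the choice between \<open>y\<^sup>\<alpha>\<close> and \<open>y\<^sup>\<beta>\<close> can correct for any power.
\<close>

lemma extremal_completes:
  fixes m n l w :: nat and s \<alpha> \<beta> :: int and \<gamma> :: "nat \<Rightarrow> int"
  assumes m: "m \<ge> 2" and n: "n \<ge> 3" and s: "[s ^ m = 1] (mod int n)"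
    and z: "z \<in> carrier (metacyclic m n s)"
    and cop: "coprime (\<alpha> - \<beta>) (int n)" "coprime w m" and l: "1 \<le> l" "l \<le> m"
  defines "G \<equiv> metacyclic m n s" and "x \<equiv> gen_x m" and "y \<equiv> gen_y n"
  shows "\<exists>U. U \<subseteq># replicate_mset (l * n - 1) (y [^]\<^bsub>G\<^esub> \<alpha>)
            + replicate_mset ((m + 1 - l) * n - 1) (y [^]\<^bsub>G\<^esub> \<beta>)
            + {# x [^]\<^bsub>G\<^esub> w \<otimes>\<^bsub>G\<^esub> y [^]\<^bsub>G\<^esub> \<gamma> i. i \<in># mset_set {1..m - 1} #} \<and>
          size U = m * n - 2 \<and> product_one G (add_mset z U)"
proof -
  have pos: "m > 0" "n > 0"
    using m n by simp_all
  interpret group G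
    unfolding G_def using pos s by (rule group_metacyclic)
  have y: "y \<in> carrier G" and x: "x \<in> carrier G"
    using gens_in_carrier[OF pos s] by (simp_all add: G_def x_def y_def)
  note x_pow = gen_x_pow[OF pos s, folded G_def x_def]
  note y_pow = gen_y_int_pow[OF pos s, folded G_def y_def]
  define h where "h i = x [^]\<^bsub>G\<^esub> w \<otimes>\<^bsub>G\<^esub> y [^]\<^bsub>G\<^esub> \<gamma> i" for i
  have h: "h i \<in> carrier G" "fst (h i) = w mod m" for i
    using x y by (simp add: h_def) (simp add: h_def x_pow y_pow, simp add: G_def mult_metacyclic)
  \<comment> \<open>Some \<open>j < m\<close> of the terms \<open>h i\<close> cancel the exponent of \<open>x\<close> in \<open>z\<close>.\<close>
  obtain j where j: "j < m" "m dvd fst z + j * w"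
  proof -
    have "coprime (int w) (int m)"
      using cop(2) by simp
    then obtain u where u: "0 \<le> u" "u < 0 + int m" "int m dvd int (fst z) + u * int w"
      using linear_congruence_in_window[of "int w" "int m" 0 "int (fst z)"] pos by auto
    then have "nat u < m" "int m dvd int (fst z + nat u * w)"
      by auto
    with that show ?thesis
      unfolding int_dvd_int_iff by blast
  qed
  define gs where "gs = z # map h [1..<Suc j]"
  have gs: "set gs \<subseteq> carrier G"
    using z h(1) by (auto simp: gs_def G_def)
  have "(\<Sum>g\<leftarrow>gs. fst g) mod m = (fst z + j * (w mod m)) mod m"
    by (simp add: gs_def comp_def h(2) sum_list_triv del: upt_Suc)
  also have "\<dots> = (fst z + j * w) mod m"
    by (metis mod_add_right_eq mod_mult_right_eq)
  finally have "fst (gprod G gs) = 0"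
    using j(2) by (simp add: G_def fst_gprod mod_eq_0_iff_dvd)
  moreover have "gprod G gs \<in> carrier G"
    using gs by (rule gprod_closed)
  ultimately have "gprod G gs = y [^]\<^bsub>G\<^esub> snd (gprod G gs)"
    by (cases "gprod G gs") (simp add: y_pow, simp add: G_def carrier_metacyclic)
  then obtain c :: int where c: "gprod G gs = y [^]\<^bsub>G\<^esub> c"
    by blast
  define M where "M = m * n - 2 - j"
  define lo where "lo = (l - 1) * n - (1 + j)"
  obtain u where u: "lo \<le> u" "u < lo + n" "int n dvd (c + \<beta> * int M) + int u * (\<alpha> - \<beta>)"
  proof -
    obtain v where v: "int lo \<le> v" "v < int lo + int n"
      "int n dvd (c + \<beta> * int M) + v * (\<alpha> - \<beta>)"
      using linear_congruence_in_window[OF cop(1)] pos by (metis of_nat_0_less_iff)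
    with that[of "nat v"] show ?thesis
      by auto
  qed
  have bounds: "u \<le> l * n - 1" "u \<le> M" "M - u \<le> (m + 1 - l) * n - 1"
    using window_of_multiplicities[OF m n j(1) l] u(1,2) by (simp_all add: lo_def M_def)
  define fs where "fs = replicate u (y [^]\<^bsub>G\<^esub> \<alpha>) @ replicate (M - u) (y [^]\<^bsub>G\<^esub> \<beta>)"
  have "(y [^]\<^bsub>G\<^esub> a) [^]\<^bsub>G\<^esub> k = y [^]\<^bsub>G\<^esub> (a * int k)" for a and k :: nat
    using y by (metis int_pow_int int_pow_pow)
  then have "gprod G fs = y [^]\<^bsub>G\<^esub> (\<alpha> * int u) \<otimes>\<^bsub>G\<^esub> y [^]\<^bsub>G\<^esub> (\<beta> * int (M - u))"
    unfolding fs_def using y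
    by (subst gprod_append) (auto simp: gprod_replicate simp del: foldr_replicate)
  then have "gprod G (gs @ fs) = y [^]\<^bsub>G\<^esub> (c + (\<alpha> * int u + \<beta> * int (M - u)))"
    using y gs by (subst gprod_append) (auto simp: fs_def c int_pow_mult)
  also have "c + (\<alpha> * int u + \<beta> * int (M - u)) = (c + \<beta> * int M) + int u * (\<alpha> - \<beta>)"
    using bounds(2) by (simp add: of_nat_diff algebra_simps)
  also have "y [^]\<^bsub>G\<^esub> \<dots> = \<one>\<^bsub>G\<^esub>"
    using u(3) unfolding y_pow by (simp add: G_def one_metacyclic)
  finally have one: "gprod G (gs @ fs) = \<one>\<^bsub>G\<^esub>" .
  define U where "U = image_mset h (mset_set {1..j}) + mset fs"
  have "mset (gs @ fs) = add_mset z U"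
    by (simp add: gs_def U_def atLeastLessThanSuc_atLeastAtMost del: upt_Suc)
  with one have "product_one G (add_mset z U)"
    unfolding product_one_def by blast
  moreover have "size U = m * n - 2"
  proof -
    have "2 * 3 \<le> m * n"
      using m n by (intro mult_le_mono)
    moreover have "m * 3 \<le> m * n"
      using n by simp
    ultimately have "j + 2 \<le> m * n"
      using j(1) m by linarith
    then show ?thesis
      using bounds(2) by (simp add: U_def fs_def M_def)
  qed
  moreover have "U \<subseteq># replicate_mset (l * n - 1) (y [^]\<^bsub>G\<^esub> \<alpha>)
            + replicate_mset ((m + 1 - l) * n - 1) (y [^]\<^bsub>G\<^esub> \<beta>) + {# h i. i \<in># mset_set {1..m - 1} #}"
  proof -
    have "mset_set {1..j} \<subseteq># mset_set {1..m - 1}"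
      using j(1) by (intro subset_imp_msubset_mset_set) auto
    then have "image_mset h (mset_set {1..j}) \<subseteq># image_mset h (mset_set {1..m - 1})"
      by (rule image_mset_subseteq_mono)
    moreover have "replicate_mset u (y [^]\<^bsub>G\<^esub> \<alpha>) \<subseteq># replicate_mset (l * n - 1) (y [^]\<^bsub>G\<^esub> \<alpha>)"
      "replicate_mset (M - u) (y [^]\<^bsub>G\<^esub> \<beta>) \<subseteq># replicate_mset ((m + 1 - l) * n - 1) (y [^]\<^bsub>G\<^esub> \<beta>)"
      using bounds by (simp_all flip: count_le_replicate_mset_subset_eq)
    ultimately show ?thesis
      unfolding U_def fs_def mset_append mset_replicate add.commute[of "image_mset _ _"]
      by (intro subset_mset.add_mono)
  qed
  ultimately show ?thesis
    unfolding h_def by blast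
qed


section \<open>The Gao constant of the larger group\<close>

lemma subseteq_image_msetE:
  assumes "T \<subseteq># image_mset f \<B>"
  obtains \<T> \<R> where "\<B> = \<T> + \<R>" "T = image_mset f \<T>"
  using assms by (metis image_mset_eq_plusD subset_mset.le_iff_add)

theorem theorem3p1:
  fixes m n m0 n0 :: nat and s :: int and G0 :: "(nat \<times> int) monoid" and x y :: "nat \<times> int"
  assumes "m = 2 * m0" and "m \<ge> 4"
    and "n = 2 * n0" and "n \<ge> 6"
    and "odd s"
    and "ord (int n0) (s ^ 2) = m0"
    and "[s ^ m = 1] (mod int n)"
    and "G0 = metacyclic m0 n0 (s ^ 2)" and "x = gen_x m0" and "y = gen_y n0"
    and A: "gao_const G0 = m0 * n0 + m0 + n0 - 2"
    and B: "\<And>S. set_mset S \<subseteq> carrier G0 \<Longrightarrow> size S = gao_const G0 - 1 \<Longrightarrow>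
        product_one_free G0 (m0 * n0) S \<Longrightarrow>
        \<exists>(\<alpha>::int) (\<beta>::int) (\<gamma>::nat \<Rightarrow> int) (w::nat) (l::nat).
          \<alpha> \<in> {0..int n0 - 1} \<and> \<beta> \<in> {0..int n0 - 1} \<and>
          (\<forall>i\<in>{1..m0 - 1}. \<gamma> i \<in> {0..int n0 - 1}) \<and>
          gcd (\<alpha> - \<beta>) (int n0) = 1 \<and>
          w \<in> {1..m0 - 1} \<and> gcd w m0 = 1 \<and>
          l \<in> {1..m0} \<and>
          S = replicate_mset (l * n0 - 1) (y [^]\<^bsub>G0\<^esub> \<alpha>)
            + replicate_mset ((m0 + 1 - l) * n0 - 1) (y [^]\<^bsub>G0\<^esub> \<beta>)
            + {# x [^]\<^bsub>G0\<^esub> w \<otimes>\<^bsub>G0\<^esub> y [^]\<^bsub>G0\<^esub> \<gamma> i. i \<in># mset_set {1..m0 - 1} #}"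
  shows "gao_const (metacyclic m n s) = m * n + m + n - 2"
proof -
  let ?G = "metacyclic m n s"
  define N where "N = m0 * n0"
  have dims: "m0 \<ge> 2" "n0 \<ge> 3" "m = 2 * m0" "n = 2 * n0"
    using assms(1-4) by simp_all
  have pos: "m > 0" "n > 0" "m0 > 0" "n0 > 0"
    using dims by simp_all
  have mn: "m * n = 4 * N"
    by (simp add: N_def dims)
  have s0: "[(s ^ 2) ^ m0 = 1] (mod int n0)"
    using assms(7) cong_dvd_modulus[of "s ^ m" 1 "int n" "int n0"] by (simp add: dims flip: power_mult)
  have "N > 0"
    using pos by (simp add: N_def)
  interpret G: group ?G
    using pos(1,2) assms(7) by (rule group_metacyclic)
  interpret G0: group G0
    unfolding assms(8) using pos(3,4) s0 by (rule group_metacyclic)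
  have double: "double \<in> hom G0 ?G"
    unfolding assms(8) dims by (rule double_hom)
  have A': "has_product_one_subseq G0 N S"
    if "set_mset S \<subseteq> carrier G0" "size S \<ge> N + m0 + n0 - 2" for S
    using has_product_one_subseq_gao[OF G0.group_axioms _ that(1)] that(2) A
    by (simp add: assms(8) carrier_metacyclic order_metacyclic N_def)

  \<comment> \<open>A block is an ordered list of terms with product in the image of \<open>G0\<close>; \<open>p\<close> is that product,
      seen in \<open>G0\<close>.\<close>
  define p where "p = halve \<circ> gprod ?G"
  define block where "block gs \<longleftrightarrow> set gs \<subseteq> carrier ?G \<and> parity_class (gprod ?G gs) = (True, True)"
    for gs
  have p_closed: "p gs \<in> carrier G0" if "block gs" for gs
    using that G.gprod_closed halve_closed unfolding p_def block_def assms(8) dims comp_def by blast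
  have block_one: "product_one ?G (\<Sum>\<^sub># (image_mset mset \<B>))"
    if "\<forall>gs\<in>#\<B>. block gs" "product_one G0 (image_mset p \<B>)" for \<B>
  proof (rule product_one_blocks[OF G.group_axioms G0.group_axioms double _ that(2)])
    fix gs
    assume "gs \<in># \<B>"
    with that(1) have "block gs"
      by blast
    then show "set gs \<subseteq> carrier ?G \<and> p gs \<in> carrier G0 \<and> gprod ?G gs = double (p gs)"
      using p_closed by (simp add: block_def p_def double_halve)
  qed
  have block_carrier: "set_mset (\<Sum>\<^sub># (image_mset mset \<B>)) \<subseteq> carrier ?G" if "\<forall>gs\<in>#\<B>. block gs" for \<B>
    using that by (auto simp: block_def)
  have image_closed: "set_mset (image_mset p \<B>) \<subseteq> carrier G0" if "\<forall>gs\<in>#\<B>. block gs" for \<B>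
    using that p_closed by auto
  have size_pairs: "size (\<Sum>\<^sub># (image_mset mset \<B>)) = 2 * size \<B>"
    if "\<forall>gs\<in>#\<B>. length gs = 2" for \<B> :: "(nat \<times> int) list multiset"
    using that by (induction \<B>) auto
  have join: "product_one ?G (\<Sum>\<^sub># (image_mset mset \<T>) + \<Sum>\<^sub># (image_mset mset \<U>))"
    if "\<forall>gs\<in>#\<T>. block gs" "product_one G0 (image_mset p \<T>)"
      "\<forall>gs\<in>#\<U>. block gs" "product_one G0 (image_mset p \<U>)" for \<T> \<U>
    using that by (intro G.product_one_union block_one block_carrier)
  have split_off: "\<exists>\<T> \<R>. \<B> = \<T> + \<R> \<and> size \<T> = N \<and> product_one G0 (image_mset p \<T>)"
    if "has_product_one_subseq G0 N (image_mset p \<B>)" for \<B>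
    using that unfolding has_product_one_subseq_def by (metis size_image_mset subseteq_image_msetE)

  have upper: "has_product_one_subseq ?G (order ?G) S"
    if S: "set_mset S \<subseteq> carrier ?G" "size S = Suc (m * n + m + n - 3)" for S
  proof -
    obtain \<P> L where PL: "S = \<Sum>\<^sub># (image_mset mset \<P>) + L"
      "\<forall>gs\<in>#\<P>. \<exists>g h. gs = [g, h] \<and> parity_class g = parity_class h"
      "image_mset parity_class L \<subseteq># mset_set UNIV"
      using pair_by_class[of S parity_class] by blast
    have pairs: "\<forall>gs\<in>#\<P>. length gs = 2"
      using PL(2) by auto
    have "\<forall>gs\<in>#\<P>. block gs"
    proof
      fix gs
      assume gs: "gs \<in># \<P>"
      then have "set gs \<subseteq> set_mset S"
        by (auto simp: PL(1))
      moreover have "parity_class (gprod ?G gs) = (True, True)"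
        using PL(2) gs by (auto simp: dims parity_class_gprod[OF \<open>odd s\<close>])
      ultimately show "block gs"
        using S(1) by (auto simp: block_def)
    qed
    note blocks = this
    have size: "2 * size \<P> + size L + 2 = 4 * N + 2 * m0 + 2 * n0"
      using S(2) size_pairs[OF pairs] dims mn by (simp add: PL(1))
    have "size L \<le> 4"
      using size_mset_mono[OF PL(3)] size_parity_classes by (metis size_image_mset)
    have "size (image_mset p \<P>) \<ge> N + m0 + n0 - 2"
      using size \<open>size L \<le> 4\<close> \<open>N > 0\<close> unfolding size_image_mset by linarith
    then obtain \<T> \<R> where TR: "\<P> = \<T> + \<R>" "size \<T> = N" "product_one G0 (image_mset p \<T>)"
      using split_off A' image_closed[OF blocks] by blast
    have two: "has_product_one_subseq ?G (order ?G) S" if more: "has_product_one_subseq G0 N (image_mset p \<R>)"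
    proof -
      obtain \<U> \<V> where UV: "\<R> = \<U> + \<V>" "size \<U> = N" "product_one G0 (image_mset p \<U>)"
        using split_off[OF more] by blast
      let ?T = "\<Sum>\<^sub># (image_mset mset \<T>) + \<Sum>\<^sub># (image_mset mset \<U>)"
      have "product_one ?G ?T"
        using blocks TR UV by (intro join) auto
      moreover have "size ?T = 4 * N"
        using size_pairs[of \<T>] size_pairs[of \<U>] pairs TR UV by simp
      moreover have "?T \<subseteq># S"
        by (simp add: PL(1) TR(1) UV(1))
      ultimately show ?thesis
        unfolding has_product_one_subseq_def order_metacyclic mn by blast
    qed
    \<comment> \<open>One extraction short: the four leftover terms now act as a block that counts for two pairs,
        which is why \<open>N - 2\<close> pairs are added to it.\<close>
    show ?thesis
    proof (rule ccontr)
      assume contra: "\<not> ?thesis"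
      then have free: "product_one_free G0 N (image_mset p \<R>)"
        using two by blast
      have R_closed: "set_mset (image_mset p \<R>) \<subseteq> carrier G0"
        using blocks TR(1) by (intro image_closed) simp
      have size_R: "size \<P> = N + size \<R>"
        by (simp add: TR(1,2))
      have "size \<R> < N + m0 + n0 - 2"
        using free A'[OF R_closed] by (metis not_le size_image_mset)
      then have short: "size \<R> + 3 \<le> N + m0 + n0"
        by linarith
      have "size L \<ge> 4"
        using size short unfolding size_R by simp
      then obtain gs where gs: "mset gs = L" "size L = 4" "parity_class (gprod ?G gs) = (True, True)"
        using transversal_product_even[OF \<open>odd s\<close> PL(3)] dims by blast
      have gs_block: "block gs"
        using gs S(1) by (auto simp: block_def PL(1) simp flip: set_mset_mset)
      have "size (image_mset p \<R>) = gao_const G0 - 1"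
        using size gs(2) dims(1,2) unfolding A size_R by (simp flip: N_def)
      from B[OF R_closed this free[unfolded N_def]] obtain \<alpha> \<beta> \<gamma> w l where
        cop: "coprime (\<alpha> - \<beta>) (int n0)" "coprime w m0" and l: "1 \<le> l" "l \<le> m0" and
        R_form: "image_mset p \<R> = replicate_mset (l * n0 - 1) (y [^]\<^bsub>G0\<^esub> (\<alpha>::int))
            + replicate_mset ((m0 + 1 - l) * n0 - 1) (y [^]\<^bsub>G0\<^esub> (\<beta>::int))
            + {# x [^]\<^bsub>G0\<^esub> (w::nat) \<otimes>\<^bsub>G0\<^esub> y [^]\<^bsub>G0\<^esub> (\<gamma> i::int). i \<in># mset_set {1..m0 - 1} #}"
        unfolding coprime_iff_gcd_eq_1 atLeastAtMost_iff by (elim exE conjE)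
      obtain U where U: "U \<subseteq># image_mset p \<R>" "size U = N - 2" "product_one G0 (add_mset (p gs) U)"
        using extremal_completes[OF dims(1,2) s0 _ cop l, of "p gs" \<gamma>] p_closed[OF gs_block]
        unfolding R_form N_def assms(8,9,10) by blast
      then obtain \<U> \<V> where UV: "\<R> = \<U> + \<V>" "U = image_mset p \<U>"
        using subseteq_image_msetE by blast
      let ?T = "\<Sum>\<^sub># (image_mset mset \<T>) + \<Sum>\<^sub># (image_mset mset (add_mset gs \<U>))"
      have "product_one ?G ?T"
        using blocks gs_block TR UV U(3) by (intro join) auto
      moreover have "size ?T = 4 * N"
      proof -
        have "2 * 3 \<le> N"
          unfolding N_def using dims by (intro mult_le_mono)
        moreover have "size \<U> = N - 2"
          using U(2) UV(2) by simp
        ultimately show ?thesis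
          using size_pairs[of \<T>] size_pairs[of \<U>] pairs TR UV gs by simp
      qed
      moreover have "?T \<subseteq># S"
        by (simp add: PL(1) TR(1) UV(1) gs(1))
      ultimately have "has_product_one_subseq ?G (order ?G) S"
        unfolding has_product_one_subseq_def order_metacyclic mn by blast
      with contra show False
        by blast
    qed
  qed

  have "gao_const ?G = Suc (m * n + m + n - 3)"
  proof (rule gao_const_eqI[OF upper])
    let ?S = "replicate_mset (m * n - 1) (0, 0) + replicate_mset (m - 1) (1, 0)
      + replicate_mset (n - 1) (0, 1) :: (nat \<times> int) multiset"
    show "set_mset ?S \<subseteq> carrier ?G" "product_one_free ?G (order ?G) ?S"
      unfolding order_metacyclic using product_one_free_example(1,3)[OF pos(1,2)] by auto
    show "size ?S = m * n + m + n - 3"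
      using product_one_free_example(2)[OF pos(1,2)] by linarith
  qed
  also have "\<dots> = m * n + m + n - 2"
    using assms(2) by linarith
  finally show ?thesis .
qed

end
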